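(* Let $d>1$ and $n\ge 4d^3$ be integers and let $D$ be a digraph of order $n$ with diameter $d$. Then $$W(D)\le dn^2-d^2n+\frac{(d-1)d^2}{2}.$$ Equality holds if and only if $D$ is isomorphic to the digraph $D_{n,d}$ defined as follows: its vertices are $u_1,\dots,u_{d-1}$ and $\ell_1,\dots,\ell_{n-d+1}$, and its arcs are $u_i\to u_{i+1}$ for $1\le i\le d-2$, together with $u_{d-1}\to \ell_j$ and $\ell_j\to u_1$ for every $1\le j\le n-d+1$ (equivalently, a directed cycle of length $d$ in which one vertex is blown up into an independent set of size $n-d+1$).
   Context: Digraphs are finite, without loops or multiple arcs (arcs in both directions between two vertices are allowed). $d(u,v)$ is the length of a shortest directed path from $u$ to $v$; the diameter is $\max_{u,v}d(u,v)$ (finite diameter means strongly connected). The Wiener index of a digraph is $W(D)=\sum d(u,v)$ over all ordered pairs $(u,v)$ of distinct vertices. *)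

theory Defs
  imports
    "Graph_Theory.Digraph_Isomorphism"
    "Graph_Theory.Pair_Digraph"
    "Graph_Theory.Shortest_Path"
begin

text \<open>
  Distances are the library's shortest-path costs for unit arc weights, hence extended reals:
  the value is \<open>\<infinity>\<close> if the second vertex is not reachable from the first. In particular a finite
  diameter forces strong connectivity. As \<open>wf_digraph.\<mu>\<close> is a locale constant, the notions
  below are meaningful for well-formed digraphs only.
\<close>

definition digraph_dist :: "('a, 'b) pre_digraph \<Rightarrow> 'a \<Rightarrow> 'a \<Rightarrow> ereal" where
  "digraph_dist G u v = wf_digraph.\<mu> G (\<lambda>_. 1) u v"

lemma (in wf_digraph) digraph_dist_eq_INF_length:
  "digraph_dist G u v = (INF p \<in> {p. awalk u p v}. ereal (real (length p)))"
proof -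
  have "awalk_cost (\<lambda>_. 1) p = real (length p)" for p
    by (induction p) simp_all
  then show ?thesis
    by (simp add: digraph_dist_def \<mu>_def)
qed

definition digraph_diameter :: "('a, 'b) pre_digraph \<Rightarrow> ereal" where
  "digraph_diameter G = (SUP (u, v) \<in> verts G \<times> verts G. digraph_dist G u v)"

definition wiener_index :: "('a, 'b) pre_digraph \<Rightarrow> ereal" where
  "wiener_index G = (\<Sum>(u, v) \<in> {(u, v). u \<in> verts G \<and> v \<in> verts G \<and> u \<noteq> v}. digraph_dist G u v)"

datatype blowup_vertex = U nat | L nat

text \<open>
  The digraph \<open>D\<^bsub>n,d\<^esub>\<close>, intended for \<open>2 \<le> d \<le> n\<close>, so that no subtraction below is truncated.
\<close>

definition blowup_cycle :: "nat \<Rightarrow> nat \<Rightarrow> (blowup_vertex, blowup_vertex \<times> blowup_vertex) pre_digraph" where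
  "blowup_cycle n d = with_proj \<lparr>
     pverts = {U i | i. 1 \<le> i \<and> i \<le> d - 1} \<union> {L j | j. 1 \<le> j \<and> j \<le> n - d + 1},
     parcs = {(U i, U (i + 1)) | i. 1 \<le> i \<and> i \<le> d - 2}
       \<union> {(U (d - 1), L j) | j. 1 \<le> j \<and> j \<le> n - d + 1}
       \<union> {(L j, U 1) | j. 1 \<le> j \<and> j \<le> n - d + 1} \<rparr>"

end

theory Submission
  imports Defs
begin

text \<open>
  Write \<open>d - \<delta> x y\<close> for the slack of a pair; maximising the Wiener index means minimising the
  total slack. Let \<open>v\<close> have minimal outgoing slack and let \<open>B\<close> be the set of vertices at
  distance less than \<open>d\<close> from \<open>v\<close>. A shortest path of length \<open>d\<close> leaving \<open>x\<close> forces slack on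
  pairs with first entry \<open>x\<close>, and a shortest path from \<open>v\<close> to \<open>w \<notin> B\<close> forces slack on pairs
  \<open>(y, w)\<close> with \<open>y \<in> B\<close>. Using the first bound for \<open>x \<notin> B\<close> and the second for the pairs from
  \<open>B\<close> to its complement counts disjoint pairs and gives the leading term. If \<open>n\<close> is large, then
  near-optimality forces \<open>B\<close> to be a path \<open>b 0, \<dots>, b (d - 1)\<close> with \<open>b 0 = v\<close>, and some
  \<open>w \<notin> B\<close> to share with \<open>v\<close> the path \<open>b 1, \<dots>, b (d - 1)\<close>. Hence
  \<open>\<delta> x y + \<delta> y x \<le> d\<close> on \<open>B\<close>, which bounds the slack inside \<open>B\<close>. In the case of equality all
  vertices outside \<open>B\<close> share this path, and distances are differences modulo \<open>d\<close> of a colouring.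
\<close>

section \<open>Sums of consecutive numbers\<close>

lemma double_sum_lessThan: "2 * (\<Sum>i<d. i) = d * (d - 1 :: nat)"
proof (induction d)
  case (Suc d)
  then show ?case by (cases d) (auto simp: algebra_simps)
qed simp

lemma double_sum_diff_lessThan: "2 * (\<Sum>i<d. d - i) = d * (d + 1 :: nat)"
proof -
  have "(\<Sum>i<d. d - i) + (\<Sum>i<d. i) = (\<Sum>i<d. d)"
    unfolding sum.distrib [symmetric] by (rule sum.cong) auto
  then have "2 * (\<Sum>i<d. d - i) + d * (d - 1) = 2 * (d * d)"
    using double_sum_lessThan [of d] by simp
  then show ?thesis by (cases d) (auto simp: algebra_simps)
qed

subsection \<open>Distances in a digraph of bounded diameter\<close>

text \<open>Arcs survive only as pairs at distance 1, and \<open>first_step\<close> encodes that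
  distances are lengths of walks. That the bound \<open>d\<close> is attained will come from
  counting.\<close>

locale hop_distance =
  fixes V :: "'a set" and \<delta> :: "'a \<Rightarrow> 'a \<Rightarrow> nat" and d :: nat
  assumes finite_V: "finite V"
    and dist_eq_0_iff: "x \<in> V \<Longrightarrow> y \<in> V \<Longrightarrow> \<delta> x y = 0 \<longleftrightarrow> x = y"
    and triangle: "x \<in> V \<Longrightarrow> y \<in> V \<Longrightarrow> z \<in> V \<Longrightarrow> \<delta> x z \<le> \<delta> x y + \<delta> y z"
    and first_step: "x \<in> V \<Longrightarrow> y \<in> V \<Longrightarrow> \<delta> x y = Suc k \<Longrightarrow> \<exists>z\<in>V. \<delta> x z = 1 \<and> \<delta> z y = k"
    and dist_le: "x \<in> V \<Longrightarrow> y \<in> V \<Longrightarrow> \<delta> x y \<le> d"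
begin

text \<open>The diagonal contributes \<open>d\<close> to each \<open>out_slack\<close>, so a shortest path of length \<open>d\<close> leaving
  \<open>x\<close> accounts for \<open>d + (d - 1) + \<dots> + 1\<close>.\<close>

definition slack :: "'a \<Rightarrow> 'a \<Rightarrow> nat" where "slack x y = d - \<delta> x y"
definition out_slack :: "'a \<Rightarrow> nat" where "out_slack x = (\<Sum>y\<in>V. slack x y)"
definition total_slack :: nat where "total_slack = (\<Sum>x\<in>V. out_slack x)"
definition near :: "'a \<Rightarrow> 'a set" where "near x = {y \<in> V. \<delta> x y < d}"

lemma dist_self [simp]: "x \<in> V \<Longrightarrow> \<delta> x x = 0"
  by (simp add: dist_eq_0_iff)

lemma near_subset: "near x \<subseteq> V"
  by (auto simp: near_def)

lemma finite_near [simp]: "finite (near x)"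
  using finite_V near_subset finite_subset by blast

lemma not_nearD: "x \<in> V \<Longrightarrow> y \<in> V - near x \<Longrightarrow> \<delta> x y = d"
  using dist_le [of x y] by (auto simp: near_def)

text \<open>Each \<open>first_step\<close> brings the target one closer, so by the triangle
  inequality it also leads one further from \<open>x\<close>.\<close>

lemma intermediate_vertex:
  assumes "x \<in> V" "y \<in> V" "i \<le> \<delta> x y"
  shows "\<exists>z\<in>V. \<delta> x z = i \<and> \<delta> z y = \<delta> x y - i"
  using assms(3)
proof (induction i)
  case 0
  then show ?case using assms by (intro bexI [of _ x]) auto
next
  case (Suc i)
  then obtain z where z: "z \<in> V" "\<delta> x z = i" "\<delta> z y = \<delta> x y - i" by auto
  with Suc.prems have "\<delta> z y = Suc (\<delta> x y - Suc i)" by simp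
  then obtain u where u: "u \<in> V" "\<delta> z u = 1" "\<delta> u y = \<delta> x y - Suc i"
    using first_step [of z y] z(1) assms(2) by blast
  have "\<delta> x u \<le> Suc i" "\<delta> x y \<le> \<delta> x u + \<delta> u y"
    using triangle [of x z u] triangle [of x u y] u z assms by auto
  with u Suc.prems show ?case by (intro bexI [of _ u]) auto
qed

lemma geodesic:
  assumes "x \<in> V" "y \<in> V" "\<delta> x y = d"
  obtains b where "\<And>i. i \<le> d \<Longrightarrow> b i \<in> V" "\<And>i. i \<le> d \<Longrightarrow> \<delta> x (b i) = i"
    "\<And>i. i \<le> d \<Longrightarrow> \<delta> (b i) y = d - i"
proof -
  have "\<forall>i. \<exists>z. i \<le> d \<longrightarrow> z \<in> V \<and> \<delta> x z = i \<and> \<delta> z y = d - i"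
    using intermediate_vertex [OF assms(1,2)] assms(3) by metis
  then obtain b where "\<forall>i. i \<le> d \<longrightarrow> b i \<in> V \<and> \<delta> x (b i) = i \<and> \<delta> (b i) y = d - i"
    by metis
  then show ?thesis using that by blast
qed

lemma inj_on_if_dist:
  assumes "\<And>i. i \<in> A \<Longrightarrow> \<delta> x (b i) = i"
  shows "inj_on b A"
  by (metis assms inj_onI)

section \<open>Slack forced by shortest paths of length \<open>d\<close>\<close>

text \<open>Otherwise every pair with first entry \<open>x\<close> would have slack at least
  1.\<close>

lemma exists_far_vertex:
  assumes "x \<in> V" "out_slack x < card V"
  obtains y where "y \<in> V" "\<delta> x y = d"
proof (rule ccontr)
  assume "\<not> thesis"
  then have "\<forall>y\<in>V. 1 \<le> slack x y"
    using that dist_le [OF assms(1)] by (force simp: slack_def)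
  then have "(\<Sum>y\<in>V. 1) \<le> out_slack x"
    unfolding out_slack_def by (intro sum_mono) auto
  with assms(2) show False by simp
qed

text \<open>The path vertices contribute \<open>d\<close>, \<open>d - 1\<close>, ..., 1, and every
  other vertex of \<open>near x\<close> at least 1. The surplus thus measures how far
  \<open>near x\<close> is from being a path.\<close>

lemma out_slack_path:
  assumes "x \<in> V" "y \<in> V" "\<delta> x y = d"
  obtains b where "\<And>i. i < d \<Longrightarrow> b i \<in> V" "\<And>i. i < d \<Longrightarrow> \<delta> x (b i) = i"
    "b ` {..<d} \<subseteq> near x" "card (b ` {..<d}) = d"
    "d * (d + 1) + 2 * card (near x - b ` {..<d}) \<le> 2 * out_slack x"
proof -
  from geodesic [OF assms] obtain b where
    b: "\<And>i. i \<le> d \<Longrightarrow> b i \<in> V" "\<And>i. i \<le> d \<Longrightarrow> \<delta> x (b i) = i"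
    by metis
  have inj: "inj_on b {..<d}"
    using b by (intro inj_on_if_dist [of _ x]) auto
  have sub: "b ` {..<d} \<subseteq> near x"
    using b by (auto simp: near_def)
  have "(\<Sum>i<d. d - i) = (\<Sum>y\<in>b ` {..<d}. slack x y)"
    using b by (simp add: sum.reindex [OF inj] slack_def)
  moreover have "card (near x - b ` {..<d}) = (\<Sum>y\<in>near x - b ` {..<d}. 1)"
    by simp
  then have "card (near x - b ` {..<d}) \<le> (\<Sum>y\<in>near x - b ` {..<d}. slack x y)"
    by (simp only:) (rule sum_mono, auto simp: slack_def near_def)
  moreover have "(\<Sum>y\<in>near x. slack x y)
      = (\<Sum>y\<in>near x - b ` {..<d}. slack x y) + (\<Sum>y\<in>b ` {..<d}. slack x y)"
    using sub by (intro sum.subset_diff) auto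
  moreover have "(\<Sum>y\<in>near x. slack x y) \<le> out_slack x"
    unfolding out_slack_def using near_subset finite_V by (intro sum_mono2) auto
  ultimately have "d * (d + 1) + 2 * card (near x - b ` {..<d}) \<le> 2 * out_slack x"
    using double_sum_diff_lessThan [of d] by linarith
  with b sub inj show ?thesis by (intro that [of b]) (auto simp: card_image)
qed

lemma out_slack_ge:
  assumes "x \<in> V" "d * (d + 1) \<le> 2 * card V"
  shows "d * (d + 1) \<le> 2 * out_slack x"
proof (cases "out_slack x < card V")
  case True
  with assms(1) obtain y where "y \<in> V" "\<delta> x y = d" by (rule exists_far_vertex)
  with assms(1) show ?thesis by (metis add_leD1 out_slack_path)
next
  case False
  with assms(2) show ?thesis by simp
qed

text \<open>The same count read from the far end: the vertex at position \<open>i\<close> of a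
  shortest path from \<open>v\<close> to \<open>w\<close> has slack \<open>i\<close> towards
  \<open>w\<close>.\<close>

lemma in_slack_ge:
  assumes "v \<in> V" "w \<in> V - near v"
  shows "d * (d - 1) \<le> 2 * (\<Sum>y\<in>near v. slack y w)"
proof -
  from assms not_nearD have "\<delta> v w = d" "w \<in> V" by auto
  with assms(1) geodesic obtain b where
    b: "\<And>i. i \<le> d \<Longrightarrow> b i \<in> V" "\<And>i. i \<le> d \<Longrightarrow> \<delta> v (b i) = i"
    "\<And>i. i \<le> d \<Longrightarrow> \<delta> (b i) w = d - i" by metis
  have inj: "inj_on b {..<d}"
    using b by (intro inj_on_if_dist [of _ v]) auto
  have "(\<Sum>i<d. i) = (\<Sum>y\<in>b ` {..<d}. slack y w)"
    using b by (simp add: sum.reindex [OF inj] slack_def)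
  also have "\<dots> \<le> (\<Sum>y\<in>near v. slack y w)"
    using b finite_V by (intro sum_mono2) (auto simp: near_def)
  finally show ?thesis using double_sum_lessThan [of d] by linarith
qed

section \<open>Blocks of ordered pairs cut out by \<open>near v\<close>\<close>

lemma total_slack_split:
  assumes "v \<in> V"
  shows "total_slack = (\<Sum>x\<in>V - near v. out_slack x)
     + (\<Sum>x\<in>near v. \<Sum>y\<in>V - near v. slack x y) + (\<Sum>x\<in>near v. \<Sum>y\<in>near v. slack x y)"
proof -
  have "out_slack x = (\<Sum>y\<in>V - near v. slack x y) + (\<Sum>y\<in>near v. slack x y)" for x
    unfolding out_slack_def using near_subset finite_V by (rule sum.subset_diff)
  moreover have "total_slack = (\<Sum>x\<in>V - near v. out_slack x) + (\<Sum>x\<in>near v. out_slack x)"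
    unfolding total_slack_def using near_subset finite_V by (rule sum.subset_diff)
  ultimately show ?thesis by (simp add: sum.distrib)
qed

lemma cross_slack_ge:
  assumes "v \<in> V"
  shows "card (V - near v) * (d * (d - 1)) \<le> 2 * (\<Sum>x\<in>near v. \<Sum>y\<in>V - near v. slack x y)"
proof -
  have "card (V - near v) * (d * (d - 1)) = (\<Sum>y\<in>V - near v. d * (d - 1))" by simp
  also have "\<dots> \<le> (\<Sum>y\<in>V - near v. 2 * (\<Sum>x\<in>near v. slack x y))"
    by (intro sum_mono in_slack_ge assms)
  also have "\<dots> = 2 * (\<Sum>x\<in>near v. \<Sum>y\<in>V - near v. slack x y)"
    by (subst sum.swap) (simp add: sum_distrib_left)
  finally show ?thesis .
qed

subsection \<open>The lower bound for the total slack\<close>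

text \<open>Minimality of \<open>v\<close> spreads its surplus \<open>r\<close> over all
  \<open>m\<close> vertices outside \<open>near v\<close>. As \<open>n\<close> is large,
  \<open>m * r\<close> outweighs the discarded pairs inside \<open>near v\<close>.\<close>

lemma total_slack_if_no_tight:
  assumes "1 < d" "4 * d ^ 3 \<le> card V"
    and not_tight: "\<And>x. x \<in> V \<Longrightarrow> d * (d + 1) < 2 * out_slack x"
  shows "2 * d\<^sup>2 * card V + d\<^sup>2 < 2 * total_slack + d ^ 3"
proof -
  define n where "n = card V"
  have cube: "d ^ 3 = d * (d * d)" by (simp add: power3_eq_cube)
  have d2: "2 * d \<le> d * d" using assms(1) by simp
  have d3: "2 * (d * d) \<le> d * (d * d)" using assms(1) by simp
  have n: "4 * (d * (d * d)) \<le> n" using assms(2) by (simp add: n_def cube)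
  have "V \<noteq> {}" using n d2 d3 assms(1) by (auto simp: n_def)
  then have "\<exists>v\<in>V. \<forall>x\<in>V. out_slack v \<le> out_slack x"
    using finite_V by (metis arg_min_least arg_min_if_finite(1))
  then obtain v where v: "v \<in> V" and v_min: "\<And>x. x \<in> V \<Longrightarrow> out_slack v \<le> out_slack x"
    by blast
  show ?thesis
  proof (cases "d * d \<le> out_slack v")
    case True
    have "n * (d * d) = (\<Sum>x\<in>V. d * d)" by (simp add: n_def)
    also have "\<dots> \<le> total_slack"
      unfolding total_slack_def using True v_min by (intro sum_mono) (meson order_trans)
    finally have "n * (d * d) \<le> total_slack" .
    moreover have "d\<^sup>2 < d * (d * d)" "2 * d\<^sup>2 * card V = 2 * (n * (d * d))"
      using d3 assms(1) by (auto simp: power2_eq_square n_def)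
    ultimately show ?thesis using cube by linarith
  next
    case False
    then have "out_slack v < card V" using n d3 unfolding n_def by linarith
    with v obtain y where "y \<in> V" "\<delta> v y = d" by (rule exists_far_vertex)
    with v obtain P where P: "P \<subseteq> near v" "card P = d"
      "d * (d + 1) + 2 * card (near v - P) \<le> 2 * out_slack v"
      by (metis out_slack_path)
    \<comment> \<open>A large \<open>near v\<close> makes \<open>m\<close> small, but its
      \<open>k\<close> vertices off the path also raise the surplus, by
      \<open>2 * k \<le> r\<close>.\<close>
    define k m r where "k = card (near v - P)" and "m = card (V - near v)"
      and "r = 2 * out_slack v - d * (d + 1)"
    have r: "2 * out_slack v = d * (d + 1) + r" "1 \<le> r" "2 * k \<le> r"
      using P(3) not_tight [OF v] by (auto simp: r_def k_def)
    have "finite P" using P(1) finite_near finite_subset by blast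
    then have "card (near v) = d + k"
      using P card_mono [OF finite_near P(1)] by (simp add: k_def card_Diff_subset)
    moreover have "card V = card (near v) + m"
      unfolding m_def using near_subset finite_V by (metis card_Diff_subset card_mono finite_near le_add_diff_inverse)
    ultimately have n_eq: "n = m + d + k" by (simp add: n_def)
    have "k < d * d" using r False by (simp add: algebra_simps)
    \<comment> \<open>Multiplied by \<open>r\<close>, this exceeds
      \<open>d ^ 3 + 2 * k * d\<^sup>2 + d\<^sup>2\<close>, which is the amount still missing: use
      \<open>1 \<le> r\<close> and \<open>2 * k \<le> r\<close>.\<close>
    then have m: "d * (d * d) + 2 * (d * d) + 1 \<le> m" using n n_eq d2 d3 assms(1) by linarith
    have "m * out_slack v = (\<Sum>x\<in>V - near v. out_slack v)" by (simp add: m_def)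
    also have "\<dots> \<le> (\<Sum>x\<in>V - near v. out_slack x)" using v_min by (intro sum_mono) auto
    finally have "m * (2 * out_slack v) + m * (d * (d - 1)) \<le> 2 * total_slack"
      using total_slack_split [OF v] cross_slack_ge [OF v] by (simp add: m_def)
    moreover have "2 * out_slack v + d * (d - 1) = 2 * (d * d) + r"
      using r(1) assms(1) by (cases d) (auto simp: algebra_simps)
    then have "m * (2 * out_slack v) + m * (d * (d - 1)) = 2 * (m * (d * d)) + m * r"
      by (metis (no_types, lifting) distrib_left mult.left_commute)
    moreover have "r * (d * (d * d)) + 2 * (r * (d * d)) + r \<le> m * r"
      using mult_le_mono1 [OF m, of r] by (simp add: algebra_simps)
    moreover have "d * (d * d) \<le> r * (d * (d * d))" "d * d \<le> r * (d * d)" using r(2) by auto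
    moreover have "2 * (k * (d * d)) \<le> r * (d * d)" using mult_le_mono1 [OF r(3), of "d * d"] by simp
    moreover have "n * (d * d) = m * (d * d) + d * (d * d) + k * (d * d)"
      unfolding n_eq by (simp add: algebra_simps)
    moreover have "2 * d\<^sup>2 * card V = 2 * (n * (d * d))" "d\<^sup>2 = d * d"
      by (simp_all add: n_def power2_eq_square)
    ultimately show ?thesis using r(2) cube by linarith
  qed
qed

text \<open>Vertices with \<open>2 * out_slack v = d * (d + 1)\<close>, the minimum possible, are called tight.\<close>

lemma tight_path:
  assumes v: "v \<in> V" and tight: "2 * out_slack v = d * (d + 1)" and "d * (d + 1) < 2 * card V"
  obtains b where "0 < d \<Longrightarrow> b 0 = v" "near v = b ` {..<d}"
    "\<And>i. i < d \<Longrightarrow> b i \<in> V" "\<And>i. i < d \<Longrightarrow> \<delta> v (b i) = i"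
    "\<And>i y. i < d \<Longrightarrow> y \<in> V - near v \<Longrightarrow> \<delta> (b i) y = d - i"
    "\<And>i j. i \<le> j \<Longrightarrow> j < d \<Longrightarrow> \<delta> (b i) (b j) = j - i"
proof -
  from assms(2,3) have "out_slack v < card V" by simp
  with v obtain w where w: "w \<in> V" "\<delta> v w = d" by (rule exists_far_vertex)
  with v obtain b where b: "\<And>i. i < d \<Longrightarrow> b i \<in> V" "\<And>i. i < d \<Longrightarrow> \<delta> v (b i) = i"
    "b ` {..<d} \<subseteq> near v" "d * (d + 1) + 2 * card (near v - b ` {..<d}) \<le> 2 * out_slack v"
    by (metis out_slack_path)
  then have "card (near v - b ` {..<d}) = 0" using tight by linarith
  with b(3) have near: "near v = b ` {..<d}" by (auto simp: card_eq_0_iff)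
  \<comment> \<open>Since \<open>near v\<close> is exactly the path, its vertices are determined by
    their distance from \<open>v\<close>. This identifies the intermediate vertices below.\<close>
  have unique: "y = b i" if "y \<in> V" "\<delta> v y = i" "i < d" for y i
  proof -
    from that have "y \<in> near v" by (simp add: near_def)
    with near b(2) that show ?thesis by auto
  qed
  have far: "\<delta> (b i) y = d - i" if i: "i < d" and "y \<in> V - near v" for i y
  proof -
    from that v have y: "y \<in> V" "\<delta> v y = d" by (auto intro: not_nearD)
    with v i obtain z where "z \<in> V" "\<delta> v z = i" "\<delta> z y = d - i"
      by (metis intermediate_vertex less_imp_le)
    with unique i show ?thesis by metis
  qed
  have "\<delta> (b i) (b j) = j - i" if ij: "i \<le> j" "j < d" for i j
  proof -
    have bi: "b i \<in> V" "\<delta> v (b i) = i" "\<delta> (b i) w = d - i"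
      using b far [of i w] ij w by (auto simp: near_def)
    moreover have "j - i \<le> d - i" using ij by simp
    ultimately obtain z where z: "z \<in> V" "\<delta> (b i) z = j - i" "\<delta> z w = d - i - (j - i)"
      using intermediate_vertex [of "b i" w "j - i"] w(1) by metis
    \<comment> \<open>Here \<open>z\<close> lies on a shortest path from \<open>b i\<close> to
      \<open>w\<close>; reaching it from \<open>v\<close> via \<open>b i\<close>, and
      \<open>w\<close> via \<open>z\<close>, pins its distance from \<open>v\<close> to
      \<open>j\<close>.\<close>
    have "\<delta> v z \<le> j" "d \<le> \<delta> v z + (d - j)"
      using triangle [of v "b i" z] triangle [of v z w] z bi w v ij by auto
    then have "\<delta> v z = j" using ij by simp
    with z ij unique show ?thesis by metis
  qed
  moreover have "b 0 = v" if "0 < d" using b(1,2) [of 0] that dist_eq_0_iff v by metis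
  ultimately show ?thesis using that [of b] b near far by blast
qed

text \<open>The path of \<open>w\<close> runs inside that of \<open>v\<close> after its start. A
  vertex outside both neighbourhoods is at distance \<open>d - i\<close> from the vertex at position
  \<open>i\<close> of either path, so shared vertices have equal positions.\<close>

lemma tight_paths_agree:
  assumes "1 < d" "d * (d + 1) < 2 * card V" "2 * d < card V"
    and v: "v \<in> V"
    and near_v: "near v = b ` {..<d}"
    and b: "\<And>i. i < d \<Longrightarrow> b i \<in> V" "\<And>i. i < d \<Longrightarrow> \<delta> v (b i) = i"
    and b_far: "\<And>i y. i < d \<Longrightarrow> y \<in> V - near v \<Longrightarrow> \<delta> (b i) y = d - i"
    and w: "w \<in> V - near v" "2 * out_slack w = d * (d + 1)" "near w - {w} \<subseteq> near v"
  shows "near w = insert w (b ` {1..<d})"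
    and "\<And>i. 1 \<le> i \<Longrightarrow> i < d \<Longrightarrow> \<delta> w (b i) = i"
    and "\<And>i. 1 \<le> i \<Longrightarrow> i < d \<Longrightarrow> \<delta> (b i) v = d - i"
proof -
  from w(1) have "w \<in> V" by simp
  then obtain c where "0 < d \<Longrightarrow> c 0 = w" and near_w: "near w = c ` {..<d}"
    and c: "\<And>i. i < d \<Longrightarrow> c i \<in> V" "\<And>i. i < d \<Longrightarrow> \<delta> w (c i) = i"
    and c_far: "\<And>i y. i < d \<Longrightarrow> y \<in> V - near w \<Longrightarrow> \<delta> (c i) y = d - i"
    using w(2) assms(2) by (rule tight_path) blast
  then have c0: "c 0 = w" using assms(1) by simp
  have "card (near v \<union> near w) \<le> d + d"
    unfolding near_v near_w
    by (intro order_trans [OF card_Un_le] add_mono order_trans [OF card_image_le]) auto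
  with assms(3) have "card (near v \<union> near w) < card V" by simp
  then have "\<not> V \<subseteq> near v \<union> near w" by (metis card_mono finite_UnI finite_near not_less)
  then obtain y where y: "y \<in> V - near v" "y \<in> V - near w" by blast
  have c_eq: "c i = b i" if i: "1 \<le> i" "i < d" for i
  proof -
    have "c i \<noteq> w" using c(2) [of i] i w(1) by auto
    then have "c i \<in> near v" using w(3) near_w i by auto
    then obtain j where j: "j < d" "c i = b j" unfolding near_v by auto
    then have "d - i = d - j" using b_far [of j y] c_far [of i y] y i by simp
    with i j have "i = j" by linarith
    with j show ?thesis by simp
  qed
  have "{..<d} = insert 0 {1..<d}" using assms(1) by auto
  then have "near w = insert w (c ` {1..<d})" unfolding near_w using c0 by simp
  also have "c ` {1..<d} = b ` {1..<d}" using c_eq by (intro image_cong) auto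
  finally show near_w': "near w = insert w (b ` {1..<d})" .
  show "\<delta> w (b i) = i" if "1 \<le> i" "i < d" for i
    using c(2) [of i] c_eq that by simp
  \<comment> \<open>The aim is \<open>v \<notin> near w\<close>: then the shared path leads on to
    \<open>v\<close> just as it leads to \<open>w\<close>.\<close>
  have "0 < \<delta> v z" if "z \<in> b ` {1..<d}" for z
    using b(2) that by auto
  from this [of v] have "v \<notin> b ` {1..<d}" using v by auto
  moreover have "v \<noteq> w" using w(1) v assms(1) by (auto simp: near_def)
  ultimately have "v \<in> V - near w" unfolding near_w' using v by auto
  then show "\<delta> (b i) v = d - i" if "1 \<le> i" "i < d" for i
    using c_far [of i v] c_eq that by simp
qed

text \<open>The distances of a directed \<open>d\<close>-cycle with the vertex of colour 0 blown up.\<close>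

definition cyclic_distance :: "('a \<Rightarrow> nat) \<Rightarrow> bool" where
  "cyclic_distance c \<longleftrightarrow> bij_betw c {x \<in> V. c x \<noteq> 0} {1..<d} \<and>
     (\<forall>x\<in>V. \<forall>y\<in>V. x \<noteq> y \<longrightarrow> \<delta> x y = (if c x < c y then c y - c x else d + c y - c x))"

text \<open>Either some vertices outside \<open>near v\<close> carry a surplus that gives strict
  inequality, or a tight \<open>w\<close> shares the path of \<open>v\<close>, which bounds return
  distances inside \<open>near v\<close>. Equality then makes every estimate sharp.\<close>

lemma total_slack_tight:
  assumes "1 < d" "4 * d ^ 3 \<le> card V"
    and v: "v \<in> V" and tight: "2 * out_slack v = d * (d + 1)"
  shows "2 * d\<^sup>2 * card V + d\<^sup>2 \<le> 2 * total_slack + d ^ 3"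
    and "2 * d\<^sup>2 * card V + d\<^sup>2 = 2 * total_slack + d ^ 3 \<Longrightarrow> \<exists>c. cyclic_distance c"
proof -
  define n where "n = card V"
  have cube: "d ^ 3 = d * (d * d)" by (simp add: power3_eq_cube)
  have d2: "2 * d \<le> d * d" using assms(1) by simp
  have d3: "2 * (d * d) \<le> d * (d * d)" using assms(1) by simp
  have n: "4 * (d * (d * d)) \<le> n" using assms(2) by (simp add: n_def cube)
  have n_large: "d * (d + 1) < 2 * card V" "2 * d < card V"
    using n d2 d3 assms(1) unfolding n_def distrib_left by linarith+
  obtain b where "0 < d \<Longrightarrow> b 0 = v" and near_v: "near v = b ` {..<d}"
    and b: "\<And>i. i < d \<Longrightarrow> b i \<in> V" "\<And>i. i < d \<Longrightarrow> \<delta> v (b i) = i"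
    and b_far: "\<And>i y. i < d \<Longrightarrow> y \<in> V - near v \<Longrightarrow> \<delta> (b i) y = d - i"
    and b_b: "\<And>i j. i \<le> j \<Longrightarrow> j < d \<Longrightarrow> \<delta> (b i) (b j) = j - i"
    using v tight n_large(1) by (rule tight_path) blast
  then have b0: "b 0 = v" using assms(1) by simp
  have inj_b: "inj_on b {..<d}" using b(2) by (intro inj_on_if_dist [of _ v]) auto
  have card_near: "card (near v) = d" unfolding near_v by (simp add: card_image inj_b)
  define m where "m = card (V - near v)"
  have n_eq: "n = m + d"
    unfolding n_def m_def card_Diff_subset [OF finite_near near_subset]
    using card_near card_mono [OF finite_V near_subset [of v]] by simp
  have out_ge: "d * (d + 1) \<le> 2 * out_slack x" if "x \<in> V" for x
    using that n_large(1) by (intro out_slack_ge) auto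
  define X Y Z where "X = (\<Sum>x\<in>V - near v. out_slack x)"
    and "Y = (\<Sum>x\<in>near v. \<Sum>y\<in>V - near v. slack x y)"
    and "Z = (\<Sum>x\<in>near v. \<Sum>y\<in>near v. slack x y)"
  have split: "total_slack = X + Y + Z"
    unfolding X_def Y_def Z_def by (rule total_slack_split [OF v])
  have Y: "m * (d * (d - 1)) \<le> 2 * Y"
    unfolding m_def Y_def by (rule cross_slack_ge [OF v])
  have X_eq: "2 * X = (\<Sum>x\<in>V - near v. 2 * out_slack x)"
    unfolding X_def by (simp add: sum_distrib_left)
  have X: "m * (d * (d + 1)) \<le> 2 * X"
  proof -
    have "m * (d * (d + 1)) = (\<Sum>x\<in>V - near v. d * (d + 1))" by (simp add: m_def)
    also have "\<dots> \<le> 2 * X" unfolding X_eq using out_ge by (intro sum_mono) auto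
    finally show ?thesis .
  qed
  have m_sum: "m * (d * (d + 1)) + m * (d * (d - 1)) = 2 * (m * (d * d))"
    using assms(1) by (cases d) (auto simp: algebra_simps)
  have n_sum: "2 * d\<^sup>2 * card V = 2 * (m * (d * d)) + 2 * (d * (d * d))"
    unfolding n_def [symmetric] n_eq by (simp add: power2_eq_square algebra_simps)
  have sq: "d\<^sup>2 = d * d" by (simp add: power2_eq_square)
  text \<open>A surplus of \<open>2 * m\<close> outside \<open>near v\<close> outweighs everything that the pairs inside \<open>near v\<close>
    can contribute.\<close>
  have strict: "2 * d\<^sup>2 * card V + d\<^sup>2 < 2 * total_slack + d ^ 3"
    if "m * (d * (d + 1)) + 2 * m \<le> 2 * X + d * (d + 1)"
  proof -
    have "d * (d + 1) = d * d + d" by simp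
    then have "d * (d + 1) + d * (d * d) + d * d < 2 * m"
      using n n_eq d2 d3 assms(1) by linarith
    then show ?thesis using that Y split m_sum n_sum cube sq by linarith
  qed
  let ?tight = "\<lambda>w. 2 * out_slack w = d * (d + 1)"
  let ?bound = "2 * d\<^sup>2 * card V + d\<^sup>2 \<le> 2 * total_slack + d ^ 3"
  have "?bound \<and> (2 * d\<^sup>2 * card V + d\<^sup>2 = 2 * total_slack + d ^ 3 \<longrightarrow> (\<exists>c. cyclic_distance c))"
  proof (cases "(\<exists>w\<in>V - near v. ?tight w) \<and> (\<forall>w\<in>V - near v. ?tight w \<longrightarrow> near w - {w} \<subseteq> near v)")
    case False
    then consider "\<forall>w\<in>V - near v. \<not> ?tight w"
      | w z where "w \<in> V - near v" "?tight w" "z \<in> near w" "z \<noteq> w" "z \<notin> near v" by blast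
    then have "m * (d * (d + 1)) + 2 * m \<le> 2 * X + d * (d + 1)"
    proof cases
      case 1
      have "m * (d * (d + 1)) + 2 * m = (\<Sum>x\<in>V - near v. d * (d + 1) + 2)"
        by (simp add: m_def algebra_simps)
      also have "\<dots> \<le> 2 * X" unfolding X_eq
      proof (intro sum_mono)
        fix x assume x: "x \<in> V - near v"
        then have "d * (d + 1) \<noteq> 2 * out_slack x" "d * (d + 1) \<le> 2 * out_slack x"
          using 1 out_ge by auto
        \<comment> \<open>By parity, a vertex that is not tight has a surplus of at least 2.\<close>
        moreover have "even (d * (d + 1))" by simp
        ultimately show "d * (d + 1) + 2 \<le> 2 * out_slack x" by presburger
      qed
      finally show ?thesis by simp
    next
      case 2
      from 2(1) have "w \<in> V" by simp
      then obtain c where "0 < d \<Longrightarrow> c 0 = w" and c: "near w = c ` {..<d}"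
        "\<And>i. i < d \<Longrightarrow> c i \<in> V" "\<And>i. i < d \<Longrightarrow> \<delta> w (c i) = i"
        "\<And>i y. i < d \<Longrightarrow> y \<in> V - near w \<Longrightarrow> \<delta> (c i) y = d - i"
        using 2(2) n_large(1) by (rule tight_path) blast
      from c(1) 2(3) obtain i where i: "i < d" "z = c i" by auto
      have z: "z \<in> V - near v" "w \<in> V" using 2 near_subset by auto
      \<comment> \<open>As \<open>z\<close> has position \<open>i > 0\<close> on the path of
        \<open>w\<close>, it has slack \<open>i\<close> towards every vertex outside
        \<open>near w\<close>; this alone makes its \<open>out_slack\<close> at least
        \<open>m\<close>.\<close>
      have "1 \<le> i" using c(3) [of i] i 2(4) z dist_eq_0_iff [of w z] by auto
      have "card (near w) \<le> d"
        unfolding c(1) by (rule order_trans [OF card_image_le]) auto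
      then have "m \<le> card (V - near w)"
        using n_eq near_subset [of w] finite_V
        by (simp add: n_def card_Diff_subset)
      also have "\<dots> = (\<Sum>y\<in>V - near w. 1)" by simp
      also have "\<dots> \<le> (\<Sum>y\<in>V - near w. slack z y)"
        using c(4) i \<open>1 \<le> i\<close> by (intro sum_mono) (auto simp: slack_def)
      also have "\<dots> \<le> out_slack z"
        unfolding out_slack_def using finite_V by (intro sum_mono2) auto
      finally have z_large: "m \<le> out_slack z" .
      have "card (V - near v - {z}) = m - 1" "1 \<le> m"
        using z(1) finite_V by (auto simp: m_def Suc_le_eq card_gt_0_iff)
      \<comment> \<open>The general bound is given up at \<open>z\<close> only, where
        \<open>2 * m\<close> replaces it; hence the extra \<open>d * (d + 1)\<close> in the
        claim.\<close>
      then have "m * (d * (d + 1)) = d * (d + 1) + (\<Sum>x\<in>V - near v - {z}. d * (d + 1))"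
        by (cases m) auto
      also have "\<dots> \<le> d * (d + 1) + (\<Sum>x\<in>V - near v - {z}. 2 * out_slack x)"
        using out_ge by (intro add_left_mono sum_mono) auto
      finally show ?thesis
        using z_large unfolding X_eq using sum.remove [OF _ z(1), of "\<lambda>x. 2 * out_slack x"] finite_V
        by simp
    qed
    then show ?thesis using strict by simp
  next
    case True
    then obtain w where w: "w \<in> V - near v" "?tight w" "near w - {w} \<subseteq> near v" by blast
    have agree: "near x = insert x (b ` {1..<d})"
      "\<And>i. 1 \<le> i \<Longrightarrow> i < d \<Longrightarrow> \<delta> x (b i) = i"
      "\<And>i. 1 \<le> i \<Longrightarrow> i < d \<Longrightarrow> \<delta> (b i) v = d - i"
      if "x \<in> V - near v" "?tight x" "near x - {x} \<subseteq> near v" for x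
      using tight_paths_agree [OF assms(1) n_large v near_v _ _ _ that] b b_far by blast+
    \<comment> \<open>To go back, finish the path to \<open>w\<close> in \<open>d - j\<close> steps
      and follow the path of \<open>w\<close> for \<open>i\<close> steps; for \<open>i = 0\<close>
      the path leads to \<open>v\<close> itself.\<close>
    have backward: "\<delta> (b j) (b i) \<le> d + i - j" if "i < j" "j < d" for i j
    proof (cases "i = 0")
      case True
      then show ?thesis using agree(3) [OF w, of j] b0 that by simp
    next
      case False
      have "\<delta> (b j) (b i) \<le> \<delta> (b j) w + \<delta> w (b i)"
        using b w(1) that by (intro triangle) auto
      then show ?thesis using agree(2) [OF w, of i] b_far [of j w] w(1) that False by simp
    qed
    text \<open>Each pair in \<open>near v\<close> lies on a closed walk of length \<open>d\<close> through \<open>v\<close> or \<open>w\<close>.\<close>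
    have loop: "\<delta> x y + \<delta> y x \<le> d" if xy: "x \<in> near v" "y \<in> near v" for x y
    proof -
      from xy near_v obtain i j where ij: "i < d" "x = b i" "j < d" "y = b j" by auto
      then show ?thesis
        using b_b [of i j] b_b [of j i] backward [of i j] backward [of j i]
        by (cases i j rule: linorder_cases) auto
    qed
    \<comment> \<open>Lower bound for the slack of a pair in both orders: \<open>loop\<close> leaves
      at least \<open>2 * d - d\<close>, and the diagonal gives \<open>d\<close> twice.\<close>
    let ?f = "\<lambda>x y. if x = y then 2 * d else d"
    have f_le: "?f x y \<le> slack x y + slack y x" if "x \<in> near v" "y \<in> near v" for x y
      using that loop [of x y] subsetD [OF near_subset that(1)] by (auto simp: slack_def)
    have sum_f: "(\<Sum>x\<in>near v. \<Sum>y\<in>near v. ?f x y) = d * (d * d) + d * d"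
    proof -
      have "(\<Sum>y\<in>near v. ?f x y) = d * d + d" if "x \<in> near v" for x
      proof -
        have "(\<Sum>y\<in>near v. ?f x y) = (\<Sum>y\<in>near v. d + (if x = y then d else 0))"
          by (intro sum.cong) auto
        also have "\<dots> = d * d + d" using that card_near by (simp add: sum.distrib)
        finally show ?thesis .
      qed
      then show ?thesis using card_near by (simp add: algebra_simps)
    qed
    have Z2: "2 * Z = (\<Sum>x\<in>near v. \<Sum>y\<in>near v. slack x y + slack y x)"
    proof -
      have "Z = (\<Sum>x\<in>near v. \<Sum>y\<in>near v. slack y x)"
        unfolding Z_def by (rule sum.swap)
      then show ?thesis by (simp add: sum.distrib Z_def)
    qed
    have Z: "d * (d * d) + d * d \<le> 2 * Z"
      unfolding Z2 sum_f [symmetric] using f_le by (intro sum_mono) auto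
    have ?bound using X Y Z split m_sum n_sum cube sq by linarith
    moreover have "\<exists>c. cyclic_distance c"
      if eq: "2 * d\<^sup>2 * card V + d\<^sup>2 = 2 * total_slack + d ^ 3"
    proof -
      \<comment> \<open>The bounds for \<open>X\<close>, \<open>Y\<close> and \<open>Z\<close> add
        up to the claimed bound, so equality makes each of them sharp.\<close>
      have X': "2 * X = m * (d * (d + 1))" and Z': "2 * Z = d * (d * d) + d * d"
        using eq X Y Z split m_sum n_sum cube sq by linarith+
      have all_tight: "?tight x" if "x \<in> V - near v" for x
      proof (rule ccontr)
        assume "\<not> ?tight x"
        with out_ge that have "d * (d + 1) < 2 * out_slack x" by (metis DiffD1 le_neq_implies_less)
        then have "(\<Sum>x\<in>V - near v. d * (d + 1)) < (\<Sum>x\<in>V - near v. 2 * out_slack x)"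
          using that out_ge finite_V by (intro sum_strict_mono_ex1) auto
        then show False using X' X_eq by (simp add: m_def)
      qed
      with True have sub: "near x - {x} \<subseteq> near v" if "x \<in> V - near v" for x
        using that by blast
      have loop': "\<delta> x y + \<delta> y x = d" if xy: "x \<in> near v" "y \<in> near v" "x \<noteq> y" for x y
      proof (rule ccontr)
        assume "\<delta> x y + \<delta> y x \<noteq> d"
        with loop [OF xy(1,2)] xy have less: "?f x y < slack x y + slack y x"
          by (auto simp: slack_def)
        have "(\<Sum>y\<in>near v. ?f x y) < (\<Sum>y\<in>near v. slack x y + slack y x)"
          using xy f_le less by (intro sum_strict_mono_ex1) auto
        then have "(\<Sum>x\<in>near v. \<Sum>y\<in>near v. ?f x y) < (\<Sum>x\<in>near v. \<Sum>y\<in>near v. slack x y + slack y x)"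
          using xy f_le by (intro sum_strict_mono_ex1 sum_mono ballI) auto
        then show False using Z2 Z' sum_f by simp
      qed
      \<comment> \<open>Vertices outside \<open>near v\<close> behave as copies of \<open>v\<close>
        and share its colour 0.\<close>
      define c where "c x = (if x \<in> near v then \<delta> v x else 0)" for x
      have c_b: "c (b i) = i" if "i < d" for i
        using that b near_v by (simp add: c_def)
      have c_out: "c x = 0" if "x \<notin> near v" for x
        using that by (simp add: c_def)
      have "{x \<in> V. c x \<noteq> 0} = b ` {1..<d}"
      proof -
        have "x \<in> b ` {1..<d}" if "x \<in> V" "c x \<noteq> 0" for x
        proof -
          from that have "x \<in> near v" by (auto simp: c_def split: if_splits)
          with near_v obtain i where "i < d" "x = b i" by auto
          with that c_b [of i] show ?thesis by auto
        qed
        then show ?thesis using b c_b by auto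
      qed
      then have "bij_betw c {x \<in> V. c x \<noteq> 0} {1..<d}"
        using c_b by (intro bij_betw_byWitness [where f' = b]) auto
      moreover have "\<delta> x y = (if c x < c y then c y - c x else d + c y - c x)"
        if xy: "x \<in> V" "y \<in> V" "x \<noteq> y" for x y
      proof (cases "x \<in> near v")
        case True
        with near_v obtain i where i: "i < d" "x = b i" by auto
        show ?thesis
        proof (cases "y \<in> near v")
          case True
          with near_v obtain j where j: "j < d" "y = b j" by auto
          with i xy have "i \<noteq> j" by auto
          then show ?thesis
            using i j c_b b_b [of i j] b_b [of j i] loop' [of x y] xy True \<open>x \<in> near v\<close>
            by (cases i j rule: linorder_cases) auto
        next
          case False
          then show ?thesis using b_far [of i y] i c_b c_out xy by simp
        qed
      next
        case False
        then have x: "x \<in> V - near v" "?tight x" "near x - {x} \<subseteq> near v"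
          using xy all_tight sub by auto
        show ?thesis
        proof (cases "y \<in> near x")
          case True
          then obtain i where "1 \<le> i" "i < d" "y = b i"
            using agree(1) [OF x] xy by auto
          then show ?thesis using agree(2) [OF x, of i] c_b c_out False by simp
        next
          case y: False
          \<comment> \<open>All of \<open>near v\<close> except \<open>b 0 = v\<close> lies in
            \<open>near x\<close>.\<close>
          have "c y = 0"
          proof (cases "y \<in> near v")
            case True
            with near_v obtain i where i: "i < d" "y = b i" by auto
            with y agree(1) [OF x] have "i = 0" by (cases "i = 0") auto
            with i c_b show ?thesis by simp
          qed (rule c_out)
          moreover have "\<delta> x y = d" using not_nearD xy y by simp
          ultimately show ?thesis using c_out False by simp
        qed
      qed
      ultimately show ?thesis unfolding cyclic_distance_def by blast
    qed
    ultimately show ?thesis by blast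
  qed
  then show ?bound and "2 * d\<^sup>2 * card V + d\<^sup>2 = 2 * total_slack + d ^ 3 \<Longrightarrow> \<exists>c. cyclic_distance c"
    by blast+
qed

section \<open>Cyclic colourings\<close>

text \<open>Sum the slack in both orders: vertices of different colours lie on a common closed walk
  of length \<open>d\<close> and give \<open>d\<close>, while distinct vertices of colour 0 are at
  distance \<open>d\<close> both ways and give 0.\<close>

lemma total_slack_cyclic:
  assumes "1 < d" and c: "cyclic_distance c"
  shows "2 * d\<^sup>2 * card V + d\<^sup>2 = 2 * total_slack + d ^ 3"
proof -
  define T S where "T = {x \<in> V. c x \<noteq> 0}" and "S = V - T"
  have bij: "bij_betw c T {1..<d}" using c by (simp add: cyclic_distance_def T_def)
  have V: "V = T \<union> S" "T \<inter> S = {}" "finite T" "finite S"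
    using finite_V by (auto simp: T_def S_def)
  have card_T: "card T = d - 1" using bij_betw_same_card [OF bij] by simp
  have c_less: "c x < d" if "x \<in> V" for x
    using that bij_betwE [OF bij] assms(1) by (cases "x \<in> T") (auto simp: T_def)
  let ?h = "\<lambda>x y. slack x y + slack y x"
  have h: "?h x y = (if x = y then 2 * d else if c x = c y then 0 else d)"
    if "x \<in> V" "y \<in> V" for x y
  proof (cases "x = y")
    case False
    then have "\<delta> x y = (if c x < c y then c y - c x else d + c y - c x)"
      "\<delta> y x = (if c y < c x then c x - c y else d + c x - c y)"
      using c that unfolding cyclic_distance_def by metis+
    with False c_less [OF that(1)] c_less [OF that(2)] show ?thesis
      by (auto simp: slack_def)
  qed (use that in \<open>simp add: slack_def\<close>)
  have sum_T: "(\<Sum>y\<in>V. ?h x y) = d * card V + d" if x: "x \<in> T" for x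
  proof -
    have "?h x y = d + (if x = y then d else 0)" if y: "y \<in> V" for y
    proof -
      have "x = y" if "c x = c y"
        using that x y bij by (auto simp: T_def bij_betw_def inj_on_def)
      then show ?thesis using h [of x y] x y by (auto simp: T_def)
    qed
    then have "(\<Sum>y\<in>V. ?h x y) = (\<Sum>y\<in>V. d + (if x = y then d else 0))"
      by (rule sum.cong [OF refl])
    also have "\<dots> = d * card V + d" using x finite_V by (simp add: sum.distrib T_def)
    finally show ?thesis .
  qed
  have sum_S: "(\<Sum>y\<in>V. ?h x y) = (d - 1) * d + 2 * d" if x: "x \<in> S" for x
  proof -
    have "(\<Sum>y\<in>T. ?h x y) = (\<Sum>y\<in>T. d)"
      using h x by (intro sum.cong) (auto simp: T_def S_def)
    moreover have "(\<Sum>y\<in>S. ?h x y) = (\<Sum>y\<in>S. if x = y then 2 * d else 0)"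
      using h x by (intro sum.cong) (auto simp: T_def S_def)
    moreover have "(\<Sum>y\<in>V. ?h x y) = (\<Sum>y\<in>T. ?h x y) + (\<Sum>y\<in>S. ?h x y)"
      unfolding V(1) by (rule sum.union_disjoint [OF V(3,4,2)])
    ultimately show ?thesis using x V(4) card_T by simp
  qed
  have "2 * total_slack = (\<Sum>x\<in>V. \<Sum>y\<in>V. ?h x y)"
  proof -
    have "total_slack = (\<Sum>x\<in>V. \<Sum>y\<in>V. slack y x)"
      unfolding total_slack_def out_slack_def by (rule sum.swap)
    then show ?thesis by (simp add: sum.distrib total_slack_def out_slack_def)
  qed
  also have "\<dots> = (\<Sum>x\<in>T. \<Sum>y\<in>V. ?h x y) + (\<Sum>x\<in>S. \<Sum>y\<in>V. ?h x y)"
    unfolding V(1) by (rule sum.union_disjoint [OF V(3,4,2)])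
  also have "\<dots> = (d - 1) * (d * card V + d) + card S * ((d - 1) * d + 2 * d)"
    using sum_T sum_S card_T by simp
  finally have total: "2 * total_slack = \<dots>" .
  have card_V: "card V = (d - 1) + card S" using card_Un_disjoint [OF V(3,4,2)] V(1) card_T by simp
  obtain e where e: "d = Suc e" using assms(1) by (cases d) auto
  show ?thesis unfolding total card_V
    by (simp add: e power2_eq_square power3_eq_cube algebra_simps)
qed

text \<open>Along a shortest path the colour grows by 1 modulo \<open>d\<close> at each step. This
  fixes the distance modulo \<open>d\<close>, and distinct vertices have distance between 1 and
  \<open>d\<close>.\<close>

lemma cyclic_distanceI:
  assumes "0 < d" and bij: "bij_betw c {x \<in> V. c x \<noteq> 0} {1..<d}"
    and adj: "\<And>x y. x \<in> V \<Longrightarrow> y \<in> V \<Longrightarrow> \<delta> x y = 1 \<Longrightarrow> c y = Suc (c x) mod d"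
  shows "cyclic_distance c"
proof -
  have c_less: "c x < d" if "x \<in> V" for x
    using that bij_betwE [OF bij] assms(1) by (cases "c x = 0") auto
  have c_walk: "c y = (c x + k) mod d" if "x \<in> V" "y \<in> V" "\<delta> x y = k" for x y k
    using that
  proof (induction k arbitrary: x)
    case 0
    then show ?case using c_less by (simp add: dist_eq_0_iff)
  next
    case (Suc k)
    then obtain z where z: "z \<in> V" "\<delta> x z = 1" "\<delta> z y = k" using first_step by blast
    have "c y = (c z + k) mod d" using Suc.IH z Suc.prems(2) by blast
    moreover have "c z = Suc (c x) mod d" using adj z Suc.prems(1) by blast
    ultimately show ?case by (simp add: mod_add_left_eq)
  qed
  have "\<delta> x y = (if c x < c y then c y - c x else d + c y - c x)"
    if xy: "x \<in> V" "y \<in> V" "x \<noteq> y" for x y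
  proof -
    define k where "k = \<delta> x y"
    have k: "1 \<le> k" "k \<le> d" "c y = (c x + k) mod d"
      using dist_le [OF xy(1,2)] c_walk [OF xy(1,2) refl] dist_eq_0_iff [OF xy(1,2)] xy(3)
      by (simp_all add: k_def Suc_le_eq)
    have "c x < d" using c_less xy by blast
    show ?thesis
    proof (cases "c x + k < d")
      case True
      with k show ?thesis by (simp add: k_def)
    next
      case False
      with k(2) \<open>c x < d\<close> have "(c x + k) mod d = c x + k - d" by (simp add: le_mod_geq)
      with k False show ?thesis unfolding k_def [symmetric] by simp
    qed
  qed
  with bij show ?thesis by (simp add: cyclic_distance_def)
qed

lemma cyclic_distance_eq_1_iff:
  assumes "1 < d" and c: "cyclic_distance c" and xy: "x \<in> V" "y \<in> V"
  shows "\<delta> x y = 1 \<longleftrightarrow> c y = Suc (c x) mod d"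
proof -
  have bij: "bij_betw c {x \<in> V. c x \<noteq> 0} {1..<d}" using c by (simp add: cyclic_distance_def)
  have c_less: "c x < d" if "x \<in> V" for x
    using that bij_betwE [OF bij] assms(1) by (cases "c x = 0") auto
  show ?thesis
  proof (cases "x = y")
    case True
    have "c y \<noteq> Suc (c y) mod d"
      using assms(1) c_less [OF xy(2)] by (cases "Suc (c y) = d") auto
    with True xy show ?thesis by simp
  next
    case False
    with c xy have "\<delta> x y = (if c x < c y then c y - c x else d + c y - c x)"
      unfolding cyclic_distance_def by blast
    with assms(1) c_less [OF xy(1)] c_less [OF xy(2)] show ?thesis
      by (cases "Suc (c x) = d") auto
  qed
qed

lemma total_slack_bound:
  assumes "1 < d" "4 * d ^ 3 \<le> card V"
  shows "2 * d\<^sup>2 * card V + d\<^sup>2 \<le> 2 * total_slack + d ^ 3"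
    and "2 * d\<^sup>2 * card V + d\<^sup>2 = 2 * total_slack + d ^ 3 \<longleftrightarrow> (\<exists>c. cyclic_distance c)"
proof -
  have "d < d ^ 3" using power_strict_increasing [of 1 3 d] assms(1) by simp
  moreover have "d ^ 2 < d ^ 3" using assms(1) by (intro power_strict_increasing) auto
  ultimately have large: "d * (d + 1) \<le> 2 * card V" using assms(2) by (simp add: power2_eq_square)
  have "2 * d\<^sup>2 * card V + d\<^sup>2 \<le> 2 * total_slack + d ^ 3 \<and>
    (2 * d\<^sup>2 * card V + d\<^sup>2 = 2 * total_slack + d ^ 3 \<longrightarrow> (\<exists>c. cyclic_distance c))"
  proof (cases "\<exists>v\<in>V. 2 * out_slack v = d * (d + 1)")
    case True
    with total_slack_tight [OF assms] show ?thesis by blast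
  next
    case False
    then have "d * (d + 1) < 2 * out_slack x" if "x \<in> V" for x
      using out_slack_ge [OF that large] that by (metis le_neq_implies_less)
    then show ?thesis using total_slack_if_no_tight [OF assms] by force
  qed
  with total_slack_cyclic [OF assms(1)]
  show "2 * d\<^sup>2 * card V + d\<^sup>2 \<le> 2 * total_slack + d ^ 3"
    and "2 * d\<^sup>2 * card V + d\<^sup>2 = 2 * total_slack + d ^ 3 \<longleftrightarrow> (\<exists>c. cyclic_distance c)"
    by blast+
qed

text \<open>Turns the lower bound for slack into an upper bound for the Wiener index.\<close>

lemma sum_dist_plus_total_slack: "(\<Sum>x\<in>V. \<Sum>y\<in>V. \<delta> x y) + total_slack = d * card V ^ 2"
proof -
  have "(\<Sum>y\<in>V. \<delta> x y) + out_slack x = card V * d" if "x \<in> V" for x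
    unfolding out_slack_def sum.distrib [symmetric]
    using that dist_le [of x] by (simp add: slack_def)
  then show ?thesis
    unfolding total_slack_def sum.distrib [symmetric] by (simp add: power2_eq_square)
qed

end

subsection \<open>Distances as walk lengths\<close>

text \<open>Natural-valued distance, meaningful only when \<open>v\<close> is reachable from
  \<open>u\<close>; otherwise \<open>LEAST\<close> is unspecified.\<close>

definition (in wf_digraph) hop :: "'a \<Rightarrow> 'a \<Rightarrow> nat" where
  "hop u v = (LEAST k. \<exists>p. awalk u p v \<and> length p = k)"

context wf_digraph begin

lemma hop_le_length: "awalk u p v \<Longrightarrow> hop u v \<le> length p"
  unfolding hop_def by (rule Least_le) blast

lemma hop_awalk:
  assumes "awalk u q v"
  obtains p where "awalk u p v" "length p = hop u v"
proof -
  have "\<exists>p. awalk u p v \<and> length p = hop u v"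
    unfolding hop_def by (rule LeastI_ex) (use assms in blast)
  then show ?thesis using that by blast
qed

lemma digraph_dist_eq_hop:
  assumes "awalk u q v"
  shows "digraph_dist G u v = ereal (real (hop u v))"
proof -
  obtain p where p: "awalk u p v" "length p = hop u v" using assms by (rule hop_awalk)
  show ?thesis
    unfolding digraph_dist_eq_INF_length
  proof (rule antisym)
    show "(INF p \<in> {p. awalk u p v}. ereal (real (length p))) \<le> ereal (real (hop u v))"
      using p by (intro INF_lower2 [of p]) auto
    show "ereal (real (hop u v)) \<le> (INF p \<in> {p. awalk u p v}. ereal (real (length p)))"
      using hop_le_length by (intro INF_greatest) auto
  qed
qed

lemma digraph_dist_le_diameter:
  assumes "u \<in> verts G" "v \<in> verts G"
  shows "digraph_dist G u v \<le> digraph_diameter G"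
proof -
  have "(u, v) \<in> verts G \<times> verts G" using assms by simp
  from SUP_upper [OF this, of "\<lambda>(u, v). digraph_dist G u v"]
  show ?thesis by (simp add: digraph_diameter_def)
qed

text \<open>With no walk, the distance is the infimum of the empty set, which is infinite.\<close>

lemma awalk_if_finite_diameter:
  assumes "digraph_diameter G = ereal r" "u \<in> verts G" "v \<in> verts G"
  obtains p where "awalk u p v"
proof (rule ccontr)
  assume "\<not> thesis"
  then have "{p. awalk u p v} = {}" using that by blast
  then have "digraph_dist G u v = \<infinity>"
    by (simp add: digraph_dist_eq_INF_length top_ereal_def)
  moreover have "digraph_dist G u v \<le> ereal r"
    using digraph_dist_le_diameter [OF assms(2,3)] assms(1) by simp
  ultimately show False by simp
qed

end

lemma (in digraph) hop_distance_hop: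
  assumes "digraph_diameter G = ereal (real d)"
  shows "hop_distance (verts G) hop d"
proof
  fix x y assume xy: "x \<in> verts G" "y \<in> verts G"
  obtain q where "awalk x q y" using awalk_if_finite_diameter [OF assms xy] .
  then obtain p where p: "awalk x p y" "length p = hop x y" by (rule hop_awalk)
  show "hop x y = 0 \<longleftrightarrow> x = y"
  proof
    assume "hop x y = 0"
    with p show "x = y" by (simp add: awalk_Nil_iff)
  next
    assume "x = y"
    then have "awalk x [] y" using xy by (simp add: awalk_Nil_iff)
    from hop_le_length [OF this] show "hop x y = 0" by simp
  qed
  show "hop x y \<le> d"
    using digraph_dist_le_diameter [OF xy] assms digraph_dist_eq_hop [OF p(1)] by simp
  show "hop x z \<le> hop x y + hop y z" if z: "z \<in> verts G" for z
  proof -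
    obtain q where "awalk y q z" using awalk_if_finite_diameter [OF assms xy(2) z] .
    then obtain p' where "awalk y p' z" "length p' = hop y z" by (rule hop_awalk)
    with p show ?thesis using hop_le_length [of x "p @ p'" z] by (auto intro: awalk_appendI)
  qed
  show "\<exists>z\<in>verts G. hop x z = 1 \<and> hop z y = k" if k: "hop x y = Suc k" for k
  proof -
    from p k obtain e es where es: "p = e # es" "length es = k" by (cases p) auto
    define z where "z = head G e"
    have walks: "awalk x [e] z" "awalk z es y" and z: "z \<in> verts G"
      using p es by (auto simp: z_def awalk_simps)
    have "hop x z \<le> 1" "hop z y \<le> k"
      using hop_le_length [OF walks(1)] hop_le_length [OF walks(2)] es by auto
    \<comment> \<open>Cutting off the first arc of a shortest walk gave upper bounds for both
      pieces; this inequality makes them equalities.\<close>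
    moreover have "hop x y \<le> hop x z + hop z y"
    proof -
      obtain r where "awalk x r z" "length r = hop x z" using walks(1) by (rule hop_awalk)
      moreover obtain s where "awalk z s y" "length s = hop z y" using walks(2) by (rule hop_awalk)
      ultimately show ?thesis using hop_le_length [of x "r @ s" y] by (auto intro: awalk_appendI)
    qed
    ultimately show ?thesis using k z by (intro bexI [of _ z]) auto
  qed
qed auto

lemma (in digraph) hop_eq_1_iff:
  assumes "awalk x q y"
  shows "hop x y = 1 \<longleftrightarrow> (x, y) \<in> arcs_ends G"
proof
  assume "hop x y = 1"
  moreover obtain p where "awalk x p y" "length p = hop x y" using assms by (rule hop_awalk)
  ultimately obtain e where "awalk x [e] y" by (auto simp: length_Suc_conv)
  then show "(x, y) \<in> arcs_ends G" by (force simp: awalk_simps arcs_ends_conv)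
next
  assume arc: "(x, y) \<in> arcs_ends G"
  then obtain e where e: "e \<in> arcs G" "tail G e = x" "head G e = y"
    by (auto simp: arcs_ends_conv)
  then have "awalk x [e] y" by (auto simp: awalk_simps)
  from hop_le_length [OF this] have "hop x y \<le> 1" by simp
  moreover have "hop x y \<noteq> 0"
  proof
    assume "hop x y = 0"
    moreover obtain p where "awalk x p y" "length p = hop x y" using assms by (rule hop_awalk)
    ultimately have "x = y" by (simp add: awalk_Nil_iff)
    with arc show False using adj_not_same by blast
  qed
  ultimately show "hop x y = 1" by simp
qed

subsection \<open>Recognising the blown-up cycle by a cyclic colouring\<close>

text \<open>Position on the \<open>d\<close>-cycle, with the blown-up vertex at 0.\<close>

definition blowup_color :: "blowup_vertex \<Rightarrow> nat" where
  "blowup_color x = (case x of U i \<Rightarrow> i | L j \<Rightarrow> 0)"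

lemma blowup_color_simps [simp]: "blowup_color (U i) = i" "blowup_color (L j) = 0"
  by (simp_all add: blowup_color_def)

lemma verts_blowup_cycle:
  "verts (blowup_cycle n d) = U ` {1..<d} \<union> L ` {1..n - d + 1}" if "1 < d"
  using that by (auto simp: blowup_cycle_def)

text \<open>Modulo \<open>d\<close>, the step from \<open>d - 1\<close> to 0 yields the arcs into
  the \<open>L j\<close>, and the step from 0 to 1 those leaving them.\<close>

lemma arcs_blowup_cycle:
  assumes "1 < d"
  shows "arcs (blowup_cycle n d) = {(x, y). x \<in> verts (blowup_cycle n d) \<and>
    y \<in> verts (blowup_cycle n d) \<and> blowup_color y = Suc (blowup_color x) mod d}"
    (is "_ = ?R")
proof -
  have "(x, y) \<in> arcs (blowup_cycle n d) \<longleftrightarrow> (x, y) \<in> ?R" for x y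
  proof (cases x)
    case (U i)
    then show ?thesis
      using assms by (cases y; cases "Suc i = d") (auto simp: blowup_cycle_def dest: dvd_imp_le)
  next
    case (L i)
    then show ?thesis
      using assms by (cases y) (auto simp: blowup_cycle_def)
  qed
  then show ?thesis by auto
qed

lemma bij_betw_blowup_color:
  assumes "1 < d"
  shows "bij_betw blowup_color {x \<in> verts (blowup_cycle n d). blowup_color x \<noteq> 0} {1..<d}"
  by (rule bij_betw_byWitness [where f' = U]) (auto simp: verts_blowup_cycle [OF assms])

text \<open>An isomorphism pulls \<open>blowup_color\<close> back to \<open>G\<close>. Conversely,
  each nonzero colour occurs once, so the size of class 0 is forced and any numbering of it gives an
  isomorphism.\<close>

lemma (in digraph) digraph_iso_blowup_cycle_iff:
  assumes "1 < d" "d \<le> card (verts G)"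
  shows "digraph_iso G (blowup_cycle (card (verts G)) d) \<longleftrightarrow>
    (\<exists>c. bij_betw c {x \<in> verts G. c x \<noteq> 0} {1..<d} \<and>
      (\<forall>x\<in>verts G. \<forall>y\<in>verts G. (x, y) \<in> arcs_ends G \<longleftrightarrow> c y = Suc (c x) mod d))"
    (is "?L \<longleftrightarrow> (\<exists>c. ?P c)")
proof
  let ?H = "blowup_cycle (card (verts G)) d"
  assume ?L
  then obtain f where f: "digraph_isomorphism f" and H: "?H = app_iso f G"
    by (auto simp: digraph_iso_def)
  define h where "h = iso_verts f"
  have inj: "inj_on h (verts G)" and img: "verts ?H = h ` verts G"
    using f H by (auto simp: h_def digraph_isomorphism_def)
  have "bij_betw h {x \<in> verts G. blowup_color (h x) \<noteq> 0} {x \<in> verts ?H. blowup_color x \<noteq> 0}"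
    unfolding bij_betw_def
  proof
    show "inj_on h {x \<in> verts G. blowup_color (h x) \<noteq> 0}"
      using inj by (rule inj_on_subset) blast
    show "h ` {x \<in> verts G. blowup_color (h x) \<noteq> 0} = {x \<in> verts ?H. blowup_color x \<noteq> 0}"
      unfolding img by blast
  qed
  from bij_betw_trans [OF this bij_betw_blowup_color [OF assms(1)]]
  have "bij_betw (blowup_color \<circ> h) {x \<in> verts G. (blowup_color \<circ> h) x \<noteq> 0} {1..<d}"
    by simp
  moreover have "(x, y) \<in> arcs_ends G \<longleftrightarrow> (blowup_color \<circ> h) y = Suc ((blowup_color \<circ> h) x) mod d"
    if "x \<in> verts G" "y \<in> verts G" for x y
  proof -
    have "(x, y) \<in> arcs_ends G" if "(h x, h y) = (h u, h v)" "(u, v) \<in> arcs_ends G" for u v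
    proof -
      have "x = u" "y = v"
        using that \<open>x \<in> verts G\<close> \<open>y \<in> verts G\<close> adj_in_verts [OF that(2)] inj
        by (auto dest: inj_onD)
      with that show ?thesis by simp
    qed
    then have "(x, y) \<in> arcs_ends G \<longleftrightarrow> (h x, h y) \<in> (\<lambda>(u, v). (h u, h v)) ` arcs_ends G"
      by fast
    also have "\<dots> \<longleftrightarrow> (h x, h y) \<in> arcs_ends ?H"
      unfolding H arcs_ends_app_iso_eq [OF f] h_def ..
    also have "arcs_ends ?H = arcs ?H" by (simp add: blowup_cycle_def)
    also have "(h x, h y) \<in> arcs ?H \<longleftrightarrow> blowup_color (h y) = Suc (blowup_color (h x)) mod d"
      using that img by (simp add: arcs_blowup_cycle [OF assms(1)])
    finally show ?thesis by simp
  qed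
  ultimately show "\<exists>c. ?P c" by blast
next
  let ?n = "card (verts G)"
  let ?H = "blowup_cycle ?n d"
  assume "\<exists>c. ?P c"
  then obtain c where bij: "bij_betw c {x \<in> verts G. c x \<noteq> 0} {1..<d}"
    and adj: "\<And>x y. x \<in> verts G \<Longrightarrow> y \<in> verts G \<Longrightarrow> (x, y) \<in> arcs_ends G \<longleftrightarrow> c y = Suc (c x) mod d"
    by blast
  define T S where "T = {x \<in> verts G. c x \<noteq> 0}" and "S = {x \<in> verts G. c x = 0}"
  have fin: "finite T" "finite S" "T \<inter> S = {}" and V: "verts G = T \<union> S"
    by (auto simp: T_def S_def)
  have "card T = d - 1" using bij_betw_same_card [OF bij] by (simp add: T_def)
  then have "card S = card {1..?n - d + 1}"
    using card_Un_disjoint [OF fin] V assms by simp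
  with fin(2) obtain g where g: "bij_betw g S {1..?n - d + 1}"
    using finite_same_card_bij [of S "{1..?n - d + 1}"] by auto
  define h where "h x = (if c x = 0 then L (g x) else U (c x))" for x
  have color_h: "blowup_color (h x) = c x" for x by (simp add: h_def)
  have "h ` T = U ` c ` T" by (auto simp: h_def T_def image_image intro!: image_cong)
  also have "c ` T = {1..<d}" using bij by (simp add: bij_betw_def T_def)
  finally have img_T: "h ` T = U ` {1..<d}" .
  have "h ` S = L ` g ` S" by (auto simp: h_def S_def image_image intro!: image_cong)
  also have "g ` S = {1..?n - d + 1}" using g by (simp add: bij_betw_def)
  finally have img: "h ` verts G = verts ?H"
    unfolding V image_Un img_T verts_blowup_cycle [OF assms(1)] by simp
  have inj: "inj_on h (verts G)"
  proof (rule inj_onI)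
    fix x y assume xy: "x \<in> verts G" "y \<in> verts G" "h x = h y"
    then have c_eq: "c x = c y" by (metis color_h)
    show "x = y"
    proof (cases "c x = 0")
      case True
      with xy c_eq have "x \<in> S" "y \<in> S" by (simp_all add: S_def)
      moreover have "g x = g y" using xy(3) True c_eq by (simp add: h_def)
      ultimately show ?thesis using g unfolding bij_betw_def by (blast dest: inj_onD)
    next
      case False
      with xy c_eq have "x \<in> {x \<in> verts G. c x \<noteq> 0}" "y \<in> {x \<in> verts G. c x \<noteq> 0}" by simp_all
      then show ?thesis using bij c_eq unfolding bij_betw_def by (blast dest: inj_onD)
    qed
  qed
  \<comment> \<open>The target's arcs are pairs of vertices, so an arc is sent to its pair of image
    ends; this is injective in the absence of multiple arcs.\<close>
  define f where "f = \<lparr>iso_verts = h, iso_arcs = (\<lambda>a. (h (tail G a), h (head G a))),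
    iso_head = snd, iso_tail = fst\<rparr>"
  have "digraph_isomorphism f"
    unfolding digraph_isomorphism_def
  proof (intro conjI ballI)
    show "inj_on (iso_arcs f) (arcs G)"
    proof (rule inj_onI)
      fix a b assume ab: "a \<in> arcs G" "b \<in> arcs G" "iso_arcs f a = iso_arcs f b"
      then have "h (tail G a) = h (tail G b)" "h (head G a) = h (head G b)"
        by (simp_all add: f_def)
      with ab inj have "arc_to_ends G a = arc_to_ends G b"
        by (simp add: arc_to_ends_def inj_on_eq_iff)
      with ab(1,2) show "a = b" by (rule no_multi_arcs)
    qed
    show "wf_digraph G" by (rule wf_digraph)
    show "inj_on (iso_verts f) (verts G)" using inj by (simp add: f_def)
  qed (simp_all add: f_def)
  moreover have "app_iso f G = ?H"
  proof (rule pre_digraph.equality)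
    have "arcs (app_iso f G) = (\<lambda>(x, y). (h x, h y)) ` arcs_ends G"
      by (auto simp: f_def arcs_ends_conv image_image)
    also have "arcs_ends G = {(x, y). x \<in> verts G \<and> y \<in> verts G \<and> c y = Suc (c x) mod d}"
      using adj by (auto dest: adj_in_verts)
    also have "(\<lambda>(x, y). (h x, h y)) ` \<dots> = arcs ?H"
      unfolding arcs_blowup_cycle [OF assms(1)] img [symmetric]
      by (auto simp: color_h image_iff)
    finally show "arcs (app_iso f G) = arcs ?H" .
  qed (use img in \<open>auto simp: f_def blowup_cycle_def\<close>)
  ultimately show ?L by (auto simp: digraph_iso_def)
qed

subsection \<open>The Wiener index\<close>

lemma (in digraph) wiener_index_eq_hop:
  assumes "digraph_diameter G = ereal (real d)"
  shows "wiener_index G = ereal (real (\<Sum>x\<in>verts G. \<Sum>y\<in>verts G. hop x y))"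
proof -
  interpret hop_distance "verts G" hop d using assms by (rule hop_distance_hop)
  have dist: "digraph_dist G u v = ereal (real (hop u v))" if uv: "u \<in> verts G" "v \<in> verts G" for u v
  proof -
    obtain p where "awalk u p v" using awalk_if_finite_diameter [OF assms uv] .
    then show ?thesis by (rule digraph_dist_eq_hop)
  qed
  let ?A = "{(u, v). u \<in> verts G \<and> v \<in> verts G \<and> u \<noteq> v}"
  have "wiener_index G = (\<Sum>(u, v)\<in>?A. ereal (real (hop u v)))"
    unfolding wiener_index_def by (intro sum.cong) (auto simp: dist)
  also have "\<dots> = ereal (real (\<Sum>(u, v)\<in>?A. hop u v))"
    by (simp add: case_prod_unfold)
  also have "(\<Sum>(u, v)\<in>?A. hop u v) = (\<Sum>(u, v)\<in>verts G \<times> verts G. hop u v)"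
    by (rule sum.mono_neutral_left) (auto simp: dist_eq_0_iff)
  also have "\<dots> = (\<Sum>x\<in>verts G. \<Sum>y\<in>verts G. hop x y)"
    by (simp add: sum.cartesian_product)
  finally show ?thesis .
qed

theorem theorem5p1:
  fixes D :: "('a, 'b) pre_digraph" and n d :: nat
  assumes "d > 1" and "n \<ge> 4 * d ^ 3"
    and "digraph D" and "card (verts D) = n" and "digraph_diameter D = ereal (real d)"
  shows "wiener_index D
      \<le> ereal (real d * real n ^ 2 - real d ^ 2 * real n + (real d - 1) * real d ^ 2 / 2)
    \<and> (wiener_index D
        = ereal (real d * real n ^ 2 - real d ^ 2 * real n + (real d - 1) * real d ^ 2 / 2)
      \<longleftrightarrow> digraph_iso D (blowup_cycle n d))"
proof -
  interpret digraph D by fact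
  interpret hop_distance "verts D" hop d using assms(5) by (rule hop_distance_hop)
  let ?W = "\<Sum>x\<in>verts D. \<Sum>y\<in>verts D. hop x y"
  let ?bound = "real d * real n ^ 2 - real d ^ 2 * real n + (real d - 1) * real d ^ 2 / 2"
  have W: "wiener_index D = ereal (real ?W)"
    using assms(5) by (rule wiener_index_eq_hop)
  have "real (?W + total_slack) = real (d * n ^ 2)"
    using sum_dist_plus_total_slack assms(4) by simp
  then have real_W: "real ?W = real d * real n ^ 2 - real total_slack" by simp
  have cube: "real d ^ 3 = real d * real d ^ 2" by (simp add: power3_eq_cube power2_eq_square)
  have large: "4 * d ^ 3 \<le> card (verts D)" using assms by simp
  \<comment> \<open>Doubling clears the fraction and moving the negative terms across leaves natural
    numbers, the form of \<open>total_slack_bound\<close>.\<close>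
  have le_iff: "real ?W \<le> ?bound \<longleftrightarrow>
      real (2 * d\<^sup>2 * n + d\<^sup>2) \<le> real (2 * total_slack + d ^ 3)"
    and eq_iff: "real ?W = ?bound \<longleftrightarrow>
      real (2 * d\<^sup>2 * n + d\<^sup>2) = real (2 * total_slack + d ^ 3)"
    unfolding real_W by (auto simp: cube field_simps)
  have "d \<le> d ^ 3" using power_increasing [of 1 3 d] assms(1) by simp
  then have "d \<le> card (verts D)" using large by linarith
  have "digraph_iso D (blowup_cycle n d) \<longleftrightarrow> (\<exists>c. cyclic_distance c)"
  proof -
    have adj: "(x, y) \<in> arcs_ends D \<longleftrightarrow> hop x y = 1" if xy: "x \<in> verts D" "y \<in> verts D" for x y
    proof -
      obtain p where "awalk x p y" using awalk_if_finite_diameter [OF assms(5) xy] .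
      then show ?thesis using hop_eq_1_iff by blast
    qed
    have "cyclic_distance c \<longleftrightarrow> bij_betw c {x \<in> verts D. c x \<noteq> 0} {1..<d} \<and>
        (\<forall>x\<in>verts D. \<forall>y\<in>verts D. (x, y) \<in> arcs_ends D \<longleftrightarrow> c y = Suc (c x) mod d)" for c
    proof
      assume c: "cyclic_distance c"
      then have "bij_betw c {x \<in> verts D. c x \<noteq> 0} {1..<d}"
        by (simp add: cyclic_distance_def)
      with c show "bij_betw c {x \<in> verts D. c x \<noteq> 0} {1..<d} \<and>
          (\<forall>x\<in>verts D. \<forall>y\<in>verts D. (x, y) \<in> arcs_ends D \<longleftrightarrow> c y = Suc (c x) mod d)"
        using adj cyclic_distance_eq_1_iff [OF assms(1)] by blast
    next
      assume "bij_betw c {x \<in> verts D. c x \<noteq> 0} {1..<d} \<and>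
          (\<forall>x\<in>verts D. \<forall>y\<in>verts D. (x, y) \<in> arcs_ends D \<longleftrightarrow> c y = Suc (c x) mod d)"
      then show "cyclic_distance c"
        using adj assms(1) by (intro cyclic_distanceI) auto
    qed
    then show ?thesis
      using digraph_iso_blowup_cycle_iff [OF assms(1) \<open>d \<le> card (verts D)\<close>] assms(4) by simp
  qed
  moreover have "real ?W \<le> ?bound"
    unfolding le_iff of_nat_le_iff using total_slack_bound(1) [OF assms(1) large] assms(4) by simp
  moreover have "real ?W = ?bound \<longleftrightarrow> (\<exists>c. cyclic_distance c)"
    unfolding eq_iff of_nat_eq_iff using total_slack_bound(2) [OF assms(1) large] assms(4) by simp
  ultimately show ?thesis unfolding W by simp
qed

end
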